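(* Let $q_1,q_2$ be integers with $1\le q_1\le q_2$, $A=\begin{pmatrix}3q_1&0\\0&3q_2\end{pmatrix}$, $\mathcal{D}=\left\{\begin{pmatrix}0\\0\end{pmatrix},\begin{pmatrix}1\\0\end{pmatrix},\begin{pmatrix}0\\1\end{pmatrix}\right\}$. For $n\ge0$ let $\nu_n=\delta_{A^{-(n+1)}\mathcal{D}}*\delta_{A^{-(n+2)}\mathcal{D}}*\cdots$ (infinite convolution). Let $n\ge1$ and suppose $\Lambda$ is an orthogonal set of $\nu_n$. Then $\Lambda$ is an orthogonal set of $\nu_{n-1}$, but $\Lambda$ is not a maximal orthogonal set of $\nu_{n-1}$.
   Context: For a finite set $E\subseteq\mathbb{R}^2$, $\delta_E=\frac{1}{\#E}\sum_{e\in E}\delta_e$ is the uniform probability measure on $E$; the infinite convolution converges weakly to a Borel probability measure ($\nu_0$ is the self-affine measure $\mu_{A,\mathcal{D}}$). A countable $\Lambda\subseteq\mathbb{R}^2$ is an orthogonal set of $\mu$ if $\{e^{-2\pi i\langle\lambda,x\rangle}:\lambda\in\Lambda\}$ is orthogonal in $L^2(\mu)$; it is maximal if it is not properly contained in another orthogonal set of $\mu$. *)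

theory Defs
  imports "HOL-Probability.Probability"
begin

text \<open>The expanding matrix A = diag(3 q1, 3 q2).\<close>
definition matA :: "int \<Rightarrow> int \<Rightarrow> real^2^2" where
  "matA q1 q2 = (\<chi> i j. if i = j then (if i = 1 then 3 * real_of_int q1 else 3 * real_of_int q2) else 0)"

text \<open>The digit set D = {(0,0),(1,0),(0,1)}.\<close>
definition digitD :: "(real^2) set" where
  "digitD = {\<chi> i. 0, \<chi> i. if i = 1 then 1 else 0, \<chi> i. if i = 2 then 1 else 0}"

text \<open>Matrix powers.\<close>
primrec mpow :: "real^'n^'n \<Rightarrow> nat \<Rightarrow> real^'n^'n" where
  "mpow M 0 = mat 1"
| "mpow M (Suc k) = M ** mpow M k"

text \<open>A^{-k}.\<close>
definition Ainvpow :: "int \<Rightarrow> int \<Rightarrow> nat \<Rightarrow> real^2^2" where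
  "Ainvpow q1 q2 k = matrix_inv (mpow (matA q1 q2) k)"

text \<open>Uniform probability measure on a finite set E.\<close>
definition deltaE :: "'a set \<Rightarrow> 'a pmf" where
  "deltaE E = pmf_of_set E"

text \<open>Convolution of (discrete) probability measures.\<close>
definition conv_pmf :: "'a::plus pmf \<Rightarrow> 'a pmf \<Rightarrow> 'a pmf" where
  "conv_pmf p q = map_pmf (\<lambda>(x, y). x + y) (pair_pmf p q)"

text \<open>Finite partial convolution
  delta_{A^{-(n+1)}D} * ... * delta_{A^{-(n+m)}D}.\<close>
primrec fin_conv :: "int \<Rightarrow> int \<Rightarrow> nat \<Rightarrow> nat \<Rightarrow> (real^2) pmf" where
  "fin_conv q1 q2 n 0 = return_pmf 0"
| "fin_conv q1 q2 n (Suc m) =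
     conv_pmf (fin_conv q1 q2 n m) (deltaE ((\<lambda>d. Ainvpow q1 q2 (n + m + 1) *v d) ` digitD))"

text \<open>Weak convergence of a sequence of measures to a measure on R^2.\<close>
definition weak_conv_seq :: "(nat \<Rightarrow> (real^2) measure) \<Rightarrow> (real^2) measure \<Rightarrow> bool" where
  "weak_conv_seq M N \<longleftrightarrow>
     (\<forall>f :: real^2 \<Rightarrow> real. continuous_on UNIV f \<longrightarrow> bounded (range f) \<longrightarrow>
        (\<lambda>m. integral\<^sup>L (M m) f) \<longlonglongrightarrow> integral\<^sup>L N f)"

text \<open>Exponential e_lambda(x) = exp(-2 pi i <lambda, x>).\<close>
definition expo :: "real^2 \<Rightarrow> real^2 \<Rightarrow> complex" where
  "expo l x = exp (- 2 * pi * \<i> * complex_of_real (l \<bullet> x))"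

text \<open>Orthogonal set of mu: countable and the exponentials are pairwise orthogonal in L^2(mu).\<close>
definition orthogonal_set :: "(real^2) measure \<Rightarrow> (real^2) set \<Rightarrow> bool" where
  "orthogonal_set \<mu> \<Lambda> \<longleftrightarrow> countable \<Lambda> \<and>
     (\<forall>l\<in>\<Lambda>. \<forall>l'\<in>\<Lambda>. l \<noteq> l' \<longrightarrow>
        integral\<^sup>L \<mu> (\<lambda>x. expo l x * cnj (expo l' x)) = 0)"

definition maximal_orthogonal_set :: "(real^2) measure \<Rightarrow> (real^2) set \<Rightarrow> bool" where
  "maximal_orthogonal_set \<mu> \<Lambda> \<longleftrightarrow> orthogonal_set \<mu> \<Lambda> \<and>
     \<not> (\<exists>\<Lambda>'. \<Lambda> \<subset> \<Lambda>' \<and> orthogonal_set \<mu> \<Lambda>')"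

end

theory Submission
  imports Defs
begin

text \<open>
  The Fourier transform of \<nu>_k is the infinite product of the factors
  digit_mask (A^-j \<xi>), j > k. Hence the transform of \<nu>_(n-1) is the
  factor with j = n times the transform of \<nu>_n, and orthogonality passes
  from \<nu>_n to \<nu>_(n-1). Each factor is within 2 pi |\<xi>| 3^-j of 1, so the
  tails of the product do not vanish and a zero of the transform of \<nu>_n is a
  zero of a single factor with j > n. The terms of a vanishing mask are cube
  roots of unity, so its zeros lie in (1/3) Z^2, and the zeros of the factor
  with index j lie in (1/3) A^j Z^2, a subset of A^n Z^2. Thus an orthogonal
  set of \<nu>_n lies in one coset l0 + A^n Z^2. For z = l0 + A^n (1/3, 2/3) and
  every l in that coset, A^-n (z - l) lies in (1/3, 2/3) + Z^2, where the mask
  vanishes; so z can be added, giving a larger orthogonal set of \<nu>_(n-1).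
\<close>

definition e2pi :: "real \<Rightarrow> complex" where
  "e2pi t = cis (- (2 * pi * t))"

lemma expo_eq_e2pi: "expo l x = e2pi (l \<bullet> x)"
  by (simp add: expo_def e2pi_def cis_conv_exp algebra_simps)

lemma e2pi_add: "e2pi (s + t) = e2pi s * e2pi t"
  by (simp add: e2pi_def cis_mult algebra_simps)

lemma e2pi_0 [simp]: "e2pi 0 = 1"
  by (simp add: e2pi_def)

lemma norm_e2pi [simp]: "norm (e2pi t) = 1"
  by (simp add: e2pi_def)

lemma cnj_e2pi: "cnj (e2pi t) = e2pi (- t)"
  by (simp add: e2pi_def cis_cnj)

lemma e2pi_power: "e2pi t ^ n = e2pi (of_nat n * t)"
  by (simp add: e2pi_def Complex.DeMoivre mult_ac)

lemma e2pi_eq_1_iff: "e2pi t = 1 \<longleftrightarrow> t \<in> \<int>"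
proof -
  have "e2pi t = 1 \<longleftrightarrow> (\<exists>n::int. - (2 * pi * t) = of_int (2 * n) * pi)"
    by (simp add: e2pi_def cis_conv_exp exp_eq_1)
  also have "\<dots> \<longleftrightarrow> (\<exists>n::int. t = of_int (- n))"
  proof (intro ex_cong1)
    fix n :: int
    have "of_int (2 * n) * pi = - (2 * pi * of_int (- n))"
      by simp
    then show "- (2 * pi * t) = of_int (2 * n) * pi \<longleftrightarrow> t = of_int (- n)"
      by (simp only: neg_equal_iff_equal mult_cancel_left) (simp add: pi_neq_zero)
  qed
  also have "\<dots> \<longleftrightarrow> t \<in> \<int>"
    by (metis Ints_cases Ints_of_int minus_minus)
  finally show ?thesis .
qed

lemma e2pi_add_Ints: "n \<in> \<int> \<Longrightarrow> e2pi (t + n) = e2pi t"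
  by (simp add: e2pi_add e2pi_eq_1_iff)

lemma norm_1_minus_e2pi_le: "norm (1 - e2pi t) \<le> 2 * pi * \<bar>t\<bar>"
proof -
  have "norm (1 - e2pi t) = norm (exp (\<i> * of_real (- (2 * pi * t))) - 1)"
    by (simp add: e2pi_def cis_conv_exp norm_minus_commute)
  also have "\<dots> = 2 * \<bar>sin (- (2 * pi * t) / 2)\<bar>"
    by (rule dist_exp_i_1)
  also have "\<dots> \<le> 2 * \<bar>- (2 * pi * t) / 2\<bar>"
    using abs_sin_x_le_abs_x by simp
  finally show ?thesis
    by (simp add: abs_mult)
qed

lemma unimodular_sum_zero_imp_cube_eq_1:
  fixes u v :: complex
  assumes "norm u = 1" "norm v = 1" "1 + u + v = 0"
  shows "u ^ 3 = 1"
proof -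
  have unit_cnj: "z * cnj z = 1" if "norm z = 1" for z :: complex
    using complex_norm_square[of z] that by simp
  have u_cnj: "u * cnj u = 1"
    using assms(1) by (rule unit_cnj)
  have "norm (1 + u) = 1"
    using assms(2,3) by (metis add_eq_0_iff norm_minus_cancel)
  then have "(1 + u) * cnj (1 + u) = 1"
    by (rule unit_cnj)
  then have sum_0: "1 + u + cnj u = 0"
    using u_cnj by (simp add: algebra_simps)
  have "u * (1 + u + cnj u) = u + u * u + u * cnj u"
    by (simp add: algebra_simps)
  then have "1 + u + u * u = 0"
    using u_cnj sum_0 by (simp add: add_ac)
  then have "(u - 1) * (1 + u + u * u) = 0"
    by simp
  then show ?thesis
    by (simp add: algebra_simps power3_eq_cube)
qed

lemma one_third_notin_Ints: "(1 / 3 :: real) \<notin> \<int>"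
proof
  assume "(1 / 3 :: real) \<in> \<int>"
  then obtain n where "1 / 3 = real_of_int n"
    by (auto elim: Ints_cases)
  then have "3 * n = 1"
    by linarith
  then show False
    by presburger
qed

definition diag2 :: "real \<Rightarrow> real \<Rightarrow> real^2^2" where
  "diag2 a b = (\<chi> i j. if i = j then (if i = 1 then a else b) else 0)"

lemma diag2_mult: "diag2 a b ** diag2 c d = diag2 (a * c) (b * d)"
  unfolding diag2_def matrix_matrix_mult_def
  by (simp add: vec_eq_iff forall_2 sum_2)

lemma mat_1_eq_diag2: "mat 1 = diag2 1 1"
  unfolding diag2_def mat_def by (simp add: vec_eq_iff forall_2)

lemma diag2_mult_vec_nth [simp]:
  "(diag2 a b *v x) $ 1 = a * x $ 1" "(diag2 a b *v x) $ 2 = b * x $ 2"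
  unfolding diag2_def matrix_vector_mult_def by (simp_all add: sum_2)

lemma inner_diag2_mult_vec: "x \<bullet> (diag2 a b *v y) = (diag2 a b *v x) \<bullet> y"
  by (simp add: inner_vec_def sum_2)

lemma inj_diag2_mult_vec: "a \<noteq> 0 \<Longrightarrow> b \<noteq> 0 \<Longrightarrow> inj ((*v) (diag2 a b))"
  by (auto intro!: injI simp: vec_eq_iff forall_2 dest: arg_cong[where f = "\<lambda>x. x $ 1"]
      arg_cong[where f = "\<lambda>x. x $ 2"])

lemma matrix_inv_eqI:
  fixes A B :: "'a::field^'n^'n"
  assumes "A ** B = mat 1" "B ** A = mat 1"
  shows "matrix_inv A = B"
proof -
  have "A ** matrix_inv A = mat 1 \<and> matrix_inv A ** A = mat 1"
    unfolding matrix_inv_def by (rule someI[of _ B]) (use assms in blast)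
  then have "matrix_inv A = matrix_inv A ** (A ** B)"
    using assms(1) by simp
  also have "\<dots> = B"
    using \<open>A ** matrix_inv A = mat 1 \<and> matrix_inv A ** A = mat 1\<close>
    by (simp add: matrix_mul_assoc)
  finally show ?thesis .
qed

lemma matrix_inv_diag2: "a \<noteq> 0 \<Longrightarrow> b \<noteq> 0 \<Longrightarrow> matrix_inv (diag2 a b) = diag2 (1 / a) (1 / b)"
  by (intro matrix_inv_eqI) (simp_all add: diag2_mult mat_1_eq_diag2)

lemma mpow_matA: "mpow (matA q1 q2) k = diag2 ((3 * of_int q1) ^ k) ((3 * of_int q2) ^ k)"
proof (induction k)
  case 0
  then show ?case by (simp add: mat_1_eq_diag2)
next
  case (Suc k)
  have "matA q1 q2 = diag2 (3 * of_int q1) (3 * of_int q2)"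
    by (simp add: matA_def diag2_def)
  with Suc show ?case by (simp add: diag2_mult)
qed

lemma Ainvpow_eq_diag2:
  "q1 \<noteq> 0 \<Longrightarrow> q2 \<noteq> 0 \<Longrightarrow>
    Ainvpow q1 q2 k = diag2 (1 / (3 * of_int q1) ^ k) (1 / (3 * of_int q2) ^ k)"
  by (simp add: Ainvpow_def mpow_matA matrix_inv_diag2)

lemma Ainvpow_mult_vec_nth:
  assumes "q1 \<noteq> 0" "q2 \<noteq> 0"
  shows "(Ainvpow q1 q2 k *v \<xi>) $ 1 = \<xi> $ 1 / (3 * of_int q1) ^ k"
    and "(Ainvpow q1 q2 k *v \<xi>) $ 2 = \<xi> $ 2 / (3 * of_int q2) ^ k"
  using assms by (simp_all add: Ainvpow_eq_diag2)

lemma abs_div_power_3q_le: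
  fixes q :: int and x :: real
  assumes "1 \<le> q"
  shows "\<bar>x / (3 * of_int q) ^ k\<bar> \<le> \<bar>x\<bar> / 3 ^ k"
proof -
  have "(3::real) ^ k \<le> (3 * of_int q) ^ k"
    using assms by (intro power_mono) auto
  then show ?thesis
    by (simp add: abs_div frac_le abs_mult)
qed

lemma Ints_div_power_3q:
  fixes q :: int and x :: real
  assumes "3 * (x / (3 * of_int q) ^ j) \<in> \<int>" "k < j" "q \<noteq> 0"
  shows "x / (3 * of_int q) ^ k \<in> \<int>"
proof -
  define r :: real where "r = 3 * of_int q"
  obtain d where "j = k + Suc d"
    using less_imp_Suc_add[OF assms(2)] by auto
  then have r_j: "r ^ j = r ^ k * r ^ Suc d"
    by (simp only: power_add)
  have "r \<noteq> 0"
    using assms(3) by (simp add: r_def)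
  have r_Suc: "r ^ Suc d = 3 * of_int (q * (3 * q) ^ d)"
    by (simp add: r_def)
  have "x / r ^ k = x / (r ^ k * r ^ Suc d) * r ^ Suc d"
    using \<open>r \<noteq> 0\<close> by simp
  also have "\<dots> = 3 * (x / r ^ j) * of_int (q * (3 * q) ^ d)"
    by (simp only: r_j r_Suc mult_ac)
  also have "\<dots> \<in> \<int>"
    unfolding r_def by (rule Ints_mult[OF assms(1) Ints_of_int])
  finally show ?thesis
    unfolding r_def .
qed

definition fourier :: "(real^2) measure \<Rightarrow> real^2 \<Rightarrow> complex" where
  "fourier \<mu> \<xi> = (\<integral>x. expo \<xi> x \<partial>\<mu>)"

lemma expo_mult_cnj_expo: "expo l x * cnj (expo l' x) = expo (l - l') x"
  by (simp add: expo_eq_e2pi cnj_e2pi e2pi_add [symmetric] inner_diff_left)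

lemma orthogonal_set_iff_fourier:
  "orthogonal_set \<mu> \<Lambda> \<longleftrightarrow>
    countable \<Lambda> \<and> (\<forall>l\<in>\<Lambda>. \<forall>l'\<in>\<Lambda>. l \<noteq> l' \<longrightarrow> fourier \<mu> (l - l') = 0)"
  by (simp add: orthogonal_set_def expo_mult_cnj_expo fourier_def)

lemma fourier_uminus: "fourier \<mu> (- \<xi>) = cnj (fourier \<mu> \<xi>)"
proof -
  have "expo (- \<xi>) x = cnj (expo \<xi> x)" for x
    by (simp add: expo_eq_e2pi cnj_e2pi)
  then show ?thesis
    by (simp add: fourier_def)
qed

lemma fourier_pmf_of_set:
  "finite E \<Longrightarrow> E \<noteq> {} \<Longrightarrow>
    fourier (measure_pmf (pmf_of_set E)) \<xi> = (\<Sum>e\<in>E. expo \<xi> e) / card E"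
  unfolding fourier_def
  by (subst integral_measure_pmf[of E]) (auto simp: sum_divide_distrib scaleR_conv_of_real)

lemma fourier_conv_pmf:
  assumes "finite (set_pmf p)" "finite (set_pmf q)"
  shows "fourier (measure_pmf (conv_pmf p q)) \<xi> =
    fourier (measure_pmf p) \<xi> * fourier (measure_pmf q) \<xi>"
proof -
  have expo_add: "expo \<xi> (x + y) = expo \<xi> x * expo \<xi> y" for x y
    by (simp add: expo_eq_e2pi inner_add_right e2pi_add)
  have fourier_finite: "fourier (measure_pmf r) \<xi> = (\<Sum>x\<in>set_pmf r. pmf r x *\<^sub>R expo \<xi> x)"
    if "finite (set_pmf r)" for r :: "(real^2) pmf"
    unfolding fourier_def using that by (rule integral_measure_pmf) auto
  have "fourier (measure_pmf (conv_pmf p q)) \<xi> = (\<integral>z. expo \<xi> (fst z + snd z) \<partial>pair_pmf p q)"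
    by (simp add: fourier_def conv_pmf_def case_prod_beta)
  also have "\<dots> = (\<Sum>z\<in>set_pmf p \<times> set_pmf q. pmf (pair_pmf p q) z *\<^sub>R expo \<xi> (fst z + snd z))"
    using assms by (intro integral_measure_pmf) auto
  also have "\<dots> = (\<Sum>x\<in>set_pmf p. \<Sum>y\<in>set_pmf q. (pmf p x *\<^sub>R expo \<xi> x) * (pmf q y *\<^sub>R expo \<xi> y))"
    unfolding sum.cartesian_product
    by (intro sum.cong) (auto simp: pmf_pair expo_add scaleR_conv_of_real algebra_simps)
  also have "\<dots> = fourier (measure_pmf p) \<xi> * fourier (measure_pmf q) \<xi>"
    using assms by (simp add: fourier_finite sum_product)
  finally show ?thesis .
qed

lemma integrable_expo:
  assumes "finite_measure M" "sets M = sets borel"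
  shows "integrable M (expo \<xi>)"
proof -
  have "continuous_on UNIV (expo \<xi>)"
    unfolding expo_def by (intro continuous_intros)
  then have "expo \<xi> \<in> borel_measurable M"
    using borel_measurable_continuous_onI measurable_cong_sets[OF assms(2) refl] by blast
  then show ?thesis
    by (intro finite_measure.integrable_const_bound[OF assms(1), where B = 1])
      (auto simp: expo_eq_e2pi)
qed

lemma fourier_tendsto_weak_conv:
  assumes "weak_conv_seq (\<lambda>m. measure_pmf (P m)) M" "prob_space M" "sets M = sets borel"
  shows "(\<lambda>m. fourier (measure_pmf (P m)) \<xi>) \<longlonglongrightarrow> fourier M \<xi>"
proof -
  have "continuous_on UNIV (\<lambda>x. Re (expo \<xi> x))" "continuous_on UNIV (\<lambda>x. Im (expo \<xi> x))"
    unfolding expo_def by (intro continuous_intros)+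
  moreover have "bounded (range (\<lambda>x. Re (expo \<xi> x)))" "bounded (range (\<lambda>x. Im (expo \<xi> x)))"
    unfolding bounded_iff
    by (auto simp: expo_eq_e2pi intro!: exI[of _ 1] order_trans[OF abs_Re_le_cmod]
        order_trans[OF abs_Im_le_cmod])
  ultimately have "(\<lambda>m. \<integral>x. Re (expo \<xi> x) \<partial>P m) \<longlonglongrightarrow> (\<integral>x. Re (expo \<xi> x) \<partial>M)"
      "(\<lambda>m. \<integral>x. Im (expo \<xi> x) \<partial>P m) \<longlonglongrightarrow> (\<integral>x. Im (expo \<xi> x) \<partial>M)"
    using assms(1) unfolding weak_conv_seq_def by blast+
  moreover have "integrable M (expo \<xi>)"
    using prob_space.finite_measure[OF assms(2)] assms(3) by (rule integrable_expo)
  moreover have "integrable (measure_pmf (P m)) (expo \<xi>)" for m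
    by (rule measure_pmf.integrable_const_bound[where B = 1]) (auto simp: expo_eq_e2pi)
  ultimately show ?thesis
    unfolding tendsto_complex_iff fourier_def by simp
qed

definition digit_mask :: "real^2 \<Rightarrow> complex" where
  "digit_mask \<eta> = (1 + e2pi (\<eta> $ 1) + e2pi (\<eta> $ 2)) / 3"

lemma norm_digit_mask_le_1: "norm (digit_mask \<eta>) \<le> 1"
proof -
  have "norm (1 + e2pi (\<eta> $ 1) + e2pi (\<eta> $ 2)) \<le> norm (1 + e2pi (\<eta> $ 1)) + 1"
    using norm_triangle_ineq[of "1 + e2pi (\<eta> $ 1)" "e2pi (\<eta> $ 2)"] by simp
  also have "\<dots> \<le> 3"
    using norm_triangle_ineq[of 1 "e2pi (\<eta> $ 1)"] by simp
  finally show ?thesis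
    by (simp add: digit_mask_def norm_divide)
qed

lemma norm_1_minus_digit_mask_le: "norm (1 - digit_mask \<eta>) \<le> 2 * pi * (\<bar>\<eta> $ 1\<bar> + \<bar>\<eta> $ 2\<bar>)"
proof -
  have "1 - digit_mask \<eta> = ((1 - e2pi (\<eta> $ 1)) + (1 - e2pi (\<eta> $ 2))) / 3"
    by (simp add: digit_mask_def field_simps)
  then have "norm (1 - digit_mask \<eta>) = norm ((1 - e2pi (\<eta> $ 1)) + (1 - e2pi (\<eta> $ 2))) / 3"
    by (metis norm_divide norm_numeral)
  also have "\<dots> \<le> (2 * pi * \<bar>\<eta> $ 1\<bar> + 2 * pi * \<bar>\<eta> $ 2\<bar>) / 3"
    by (intro divide_right_mono order_trans[OF norm_triangle_ineq] add_mono norm_1_minus_e2pi_le) simp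
  also have "\<dots> \<le> 2 * pi * (\<bar>\<eta> $ 1\<bar> + \<bar>\<eta> $ 2\<bar>)"
    by (simp add: field_simps)
  finally show ?thesis .
qed

lemma digit_mask_eq_0_imp_Ints:
  assumes "digit_mask \<eta> = 0"
  shows "3 * \<eta> $ 1 \<in> \<int>" "3 * \<eta> $ 2 \<in> \<int>"
proof -
  have sum_0: "1 + e2pi (\<eta> $ 1) + e2pi (\<eta> $ 2) = 0" "1 + e2pi (\<eta> $ 2) + e2pi (\<eta> $ 1) = 0"
    using assms by (simp_all add: digit_mask_def add_ac)
  have "e2pi (\<eta> $ 1) ^ 3 = 1" "e2pi (\<eta> $ 2) ^ 3 = 1"
    by (rule unimodular_sum_zero_imp_cube_eq_1[OF norm_e2pi norm_e2pi sum_0(1)],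
        rule unimodular_sum_zero_imp_cube_eq_1[OF norm_e2pi norm_e2pi sum_0(2)])
  then show "3 * \<eta> $ 1 \<in> \<int>" "3 * \<eta> $ 2 \<in> \<int>"
    by (simp_all add: e2pi_power e2pi_eq_1_iff)
qed

lemma digit_mask_eq_0_if:
  assumes "\<eta> $ 1 - 1 / 3 \<in> \<int>" "\<eta> $ 2 - 2 / 3 \<in> \<int>"
  shows "digit_mask \<eta> = 0"
proof -
  define \<omega> where "\<omega> = e2pi (1 / 3)"
  have "e2pi (\<eta> $ 1) = \<omega>" "e2pi (\<eta> $ 2) = \<omega> ^ 2"
    using e2pi_add_Ints[OF assms(1), of "1 / 3"] e2pi_add_Ints[OF assms(2), of "2 / 3"]
    by (simp_all add: \<omega>_def e2pi_power)
  moreover have "\<omega> ^ 3 = 1" "\<omega> \<noteq> 1"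
    using one_third_notin_Ints by (simp_all add: \<omega>_def e2pi_power e2pi_eq_1_iff)
  moreover have "(\<omega> - 1) * (1 + \<omega> + \<omega> ^ 2) = \<omega> ^ 3 - 1"
    by (simp add: algebra_simps power2_eq_square power3_eq_cube)
  ultimately show ?thesis
    by (simp add: digit_mask_def)
qed

lemma fourier_digitD: "fourier (measure_pmf (deltaE digitD)) \<eta> = digit_mask \<eta>"
proof -
  define e1 :: "real^2" where "e1 = (\<chi> i. if i = 1 then 1 else 0)"
  define e2 :: "real^2" where "e2 = (\<chi> i. if i = 2 then 1 else 0)"
  have digitD: "digitD = {0, e1, e2}"
    by (simp add: digitD_def e1_def e2_def zero_vec_def)
  have distinct: "e1 \<noteq> 0" "e2 \<noteq> 0" "e1 \<noteq> e2"
    by (auto simp: e1_def e2_def vec_eq_iff forall_2)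
  have "expo \<eta> e1 = e2pi (\<eta> $ 1)" "expo \<eta> e2 = e2pi (\<eta> $ 2)"
    by (simp_all add: expo_eq_e2pi e1_def e2_def inner_vec_def sum_2)
  with distinct show ?thesis
    by (simp add: deltaE_def digitD fourier_pmf_of_set digit_mask_def expo_eq_e2pi)
qed

lemma fourier_deltaE_Ainvpow:
  assumes "q1 \<noteq> 0" "q2 \<noteq> 0"
  shows "fourier (measure_pmf (deltaE ((\<lambda>d. Ainvpow q1 q2 k *v d) ` digitD))) \<xi> =
    digit_mask (Ainvpow q1 q2 k *v \<xi>)"
proof -
  obtain a b where ab: "Ainvpow q1 q2 k = diag2 a b" "a \<noteq> 0" "b \<noteq> 0"
    using assms by (simp add: Ainvpow_eq_diag2)
  have "deltaE ((*v) (diag2 a b) ` digitD) = map_pmf ((*v) (diag2 a b)) (deltaE digitD)"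
    unfolding deltaE_def
    by (intro map_pmf_of_set_inj [symmetric] inj_on_subset[OF inj_diag2_mult_vec[OF ab(2,3)]])
      (simp_all add: digitD_def)
  then have "fourier (measure_pmf (deltaE ((*v) (diag2 a b) ` digitD))) \<xi> =
      fourier (measure_pmf (deltaE digitD)) (diag2 a b *v \<xi>)"
    by (simp add: fourier_def expo_eq_e2pi inner_diag2_mult_vec)
  then show ?thesis
    by (simp add: ab(1) fourier_digitD)
qed

lemma finite_set_pmf_fin_conv: "finite (set_pmf (fin_conv q1 q2 k m))"
proof (induction m)
  case (Suc m)
  then show ?case
    by (simp add: conv_pmf_def deltaE_def digitD_def)
qed simp

lemma fourier_fin_conv:
  assumes "q1 \<noteq> 0" "q2 \<noteq> 0"
  shows "fourier (measure_pmf (fin_conv q1 q2 k m)) \<xi> =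
    (\<Prod>i<m. digit_mask (Ainvpow q1 q2 (k + i + 1) *v \<xi>))"
proof (induction m)
  case 0
  then show ?case by (simp add: fourier_def expo_eq_e2pi)
next
  case (Suc m)
  have "finite (set_pmf (deltaE ((\<lambda>d. Ainvpow q1 q2 (k + m + 1) *v d) ` digitD)))"
    by (simp add: deltaE_def digitD_def)
  with Suc show ?case
    by (simp add: fourier_conv_pmf finite_set_pmf_fin_conv fourier_deltaE_Ainvpow assms)
qed

lemma norm_1_minus_digit_mask_Ainvpow_le:
  assumes "1 \<le> q1" "1 \<le> q2"
  shows "norm (1 - digit_mask (Ainvpow q1 q2 j *v \<xi>)) \<le> 2 * pi * (\<bar>\<xi> $ 1\<bar> + \<bar>\<xi> $ 2\<bar>) / 3 ^ j"
proof -
  have q: "q1 \<noteq> 0" "q2 \<noteq> 0"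
    using assms by auto
  have "norm (1 - digit_mask (Ainvpow q1 q2 j *v \<xi>)) \<le>
      2 * pi * (\<bar>(Ainvpow q1 q2 j *v \<xi>) $ 1\<bar> + \<bar>(Ainvpow q1 q2 j *v \<xi>) $ 2\<bar>)"
    by (rule norm_1_minus_digit_mask_le)
  also have "\<dots> \<le> 2 * pi * (\<bar>\<xi> $ 1\<bar> / 3 ^ j + \<bar>\<xi> $ 2\<bar> / 3 ^ j)"
    unfolding Ainvpow_mult_vec_nth[OF q] using assms
    by (intro mult_left_mono add_mono abs_div_power_3q_le) simp_all
  also have "\<dots> = 2 * pi * (\<bar>\<xi> $ 1\<bar> + \<bar>\<xi> $ 2\<bar>) / 3 ^ j"
    by (simp add: field_simps)
  finally show ?thesis .
qed

lemma norm_1_minus_fourier_fin_conv_le: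
  assumes "1 \<le> q1" "1 \<le> q2"
  shows "norm (1 - fourier (measure_pmf (fin_conv q1 q2 k m)) \<xi>) \<le>
    2 * pi * (\<bar>\<xi> $ 1\<bar> + \<bar>\<xi> $ 2\<bar>) / 3 ^ k"
proof -
  define C where "C = 2 * pi * (\<bar>\<xi> $ 1\<bar> + \<bar>\<xi> $ 2\<bar>)"
  let ?M = "\<lambda>i. digit_mask (Ainvpow q1 q2 (k + i + 1) *v \<xi>)"
  have "norm (1 - fourier (measure_pmf (fin_conv q1 q2 k m)) \<xi>) = norm ((\<Prod>i<m. 1) - (\<Prod>i<m. ?M i))"
    using assms by (simp add: fourier_fin_conv)
  also have "\<dots> \<le> (\<Sum>i<m. norm (1 - ?M i))"
    by (intro norm_prod_diff) (simp, rule norm_digit_mask_le_1)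
  also have "\<dots> \<le> (\<Sum>i<m. C / 3 ^ (k + 1) * (1 / 3) ^ i)"
  proof (rule sum_mono)
    fix i
    have "norm (1 - ?M i) \<le> C / 3 ^ (k + i + 1)"
      unfolding C_def using assms by (rule norm_1_minus_digit_mask_Ainvpow_le)
    also have "\<dots> = C / 3 ^ (k + 1) * (1 / 3) ^ i"
      by (simp add: power_add power_one_over)
    finally show "norm (1 - ?M i) \<le> C / 3 ^ (k + 1) * (1 / 3) ^ i" .
  qed
  also have "\<dots> = C / 3 ^ (k + 1) * (\<Sum>i<m. (1 / 3) ^ i)"
    by (simp add: sum_distrib_left)
  also have "\<dots> \<le> C / 3 ^ (k + 1) * (3 / 2)"
    using geometric_sum_less[of "1 / 3 :: real" "{..<m}"]
    by (intro mult_left_mono) (simp_all add: C_def)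
  also have "\<dots> \<le> C / 3 ^ k"
    by (simp add: C_def field_simps)
  finally show ?thesis
    unfolding C_def .
qed

locale tail_convolutions =
  fixes q1 q2 :: int and \<nu> :: "nat \<Rightarrow> (real^2) measure"
  assumes q1: "1 \<le> q1" and q2: "1 \<le> q2"
    and prob_space_nu: "\<And>k. prob_space (\<nu> k)"
    and sets_nu: "\<And>k. sets (\<nu> k) = sets borel"
    and weak_conv_nu: "\<And>k. weak_conv_seq (\<lambda>m. measure_pmf (fin_conv q1 q2 k m)) (\<nu> k)"
begin

lemma fourier_fin_conv_tendsto:
  "(\<lambda>m. fourier (measure_pmf (fin_conv q1 q2 k m)) \<xi>) \<longlonglongrightarrow> fourier (\<nu> k) \<xi>"
  using weak_conv_nu prob_space_nu sets_nu by (rule fourier_tendsto_weak_conv)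

lemma fourier_nu_Suc:
  "fourier (\<nu> k) \<xi> = digit_mask (Ainvpow q1 q2 (Suc k) *v \<xi>) * fourier (\<nu> (Suc k)) \<xi>"
proof -
  let ?M = "\<lambda>j. digit_mask (Ainvpow q1 q2 j *v \<xi>)"
  have prod: "fourier (measure_pmf (fin_conv q1 q2 j m)) \<xi> = (\<Prod>i<m. ?M (j + i + 1))" for j m
    using q1 q2 by (simp add: fourier_fin_conv)
  have "(\<lambda>m. \<Prod>i<Suc m. ?M (k + i + 1)) \<longlonglongrightarrow> fourier (\<nu> k) \<xi>"
    using LIMSEQ_Suc[OF fourier_fin_conv_tendsto[of k \<xi>]] unfolding prod .
  moreover have "(\<lambda>m. ?M (Suc k) * (\<Prod>i<m. ?M (Suc k + i + 1))) \<longlonglongrightarrow> ?M (Suc k) * fourier (\<nu> (Suc k)) \<xi>"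
    using fourier_fin_conv_tendsto[of "Suc k" \<xi>] unfolding prod by (rule tendsto_mult_left)
  moreover have "(\<Prod>i<Suc m. ?M (k + i + 1)) = ?M (Suc k) * (\<Prod>i<m. ?M (Suc k + i + 1))" for m
    by (subst prod.lessThan_Suc_shift) simp
  ultimately show ?thesis
    using LIMSEQ_unique by fastforce
qed

lemma fourier_nu_add:
  "fourier (\<nu> k) \<xi> = (\<Prod>i<j. digit_mask (Ainvpow q1 q2 (k + i + 1) *v \<xi>)) * fourier (\<nu> (k + j)) \<xi>"
proof (induction j)
  case (Suc j)
  then show ?case
    using fourier_nu_Suc[of "k + j" \<xi>] by (simp add: algebra_simps)
qed simp

lemma norm_1_minus_fourier_nu_le:
  "norm (1 - fourier (\<nu> k) \<xi>) \<le> 2 * pi * (\<bar>\<xi> $ 1\<bar> + \<bar>\<xi> $ 2\<bar>) / 3 ^ k"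
proof (rule LIMSEQ_le_const2)
  show "(\<lambda>m. norm (1 - fourier (measure_pmf (fin_conv q1 q2 k m)) \<xi>)) \<longlonglongrightarrow> norm (1 - fourier (\<nu> k) \<xi>)"
    by (intro tendsto_intros fourier_fin_conv_tendsto)
  show "\<exists>N. \<forall>m\<ge>N. norm (1 - fourier (measure_pmf (fin_conv q1 q2 k m)) \<xi>) \<le>
      2 * pi * (\<bar>\<xi> $ 1\<bar> + \<bar>\<xi> $ 2\<bar>) / 3 ^ k"
    using norm_1_minus_fourier_fin_conv_le[OF q1 q2] by blast
qed

lemma fourier_nu_eq_0_imp_digit_mask_eq_0:
  assumes "fourier (\<nu> k) \<xi> = 0"
  obtains j where "k < j" "digit_mask (Ainvpow q1 q2 j *v \<xi>) = 0"
proof -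
  define C where "C = 2 * pi * (\<bar>\<xi> $ 1\<bar> + \<bar>\<xi> $ 2\<bar>)"
  obtain K where "C < 3 ^ K"
    using real_arch_pow[of 3 C] by auto
  then have "C / 3 ^ K < 1"
    by simp
  moreover have "C / 3 ^ (k + K) \<le> C / 3 ^ K"
    by (intro divide_left_mono power_increasing) (auto simp: C_def)
  ultimately have "norm (1 - fourier (\<nu> (k + K)) \<xi>) < 1"
    using norm_1_minus_fourier_nu_le[of "k + K" \<xi>] unfolding C_def by linarith
  then have "fourier (\<nu> (k + K)) \<xi> \<noteq> 0"
    by auto
  then have "(\<Prod>i<K. digit_mask (Ainvpow q1 q2 (k + i + 1) *v \<xi>)) = 0"
    using assms fourier_nu_add[of k \<xi> K] by simp
  then obtain i where "digit_mask (Ainvpow q1 q2 (k + i + 1) *v \<xi>) = 0"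
    by auto
  then show thesis
    using that[of "k + i + 1"] by simp
qed

lemma fourier_nu_eq_0_imp_Ints:
  assumes "fourier (\<nu> k) \<xi> = 0"
  shows "(Ainvpow q1 q2 k *v \<xi>) $ i \<in> \<int>"
proof -
  have q: "q1 \<noteq> 0" "q2 \<noteq> 0"
    using q1 q2 by auto
  obtain j where "k < j" "digit_mask (Ainvpow q1 q2 j *v \<xi>) = 0"
    using assms by (rule fourier_nu_eq_0_imp_digit_mask_eq_0)
  from digit_mask_eq_0_imp_Ints[OF this(2)]
  have "3 * (\<xi> $ 1 / (3 * of_int q1) ^ j) \<in> \<int>" "3 * (\<xi> $ 2 / (3 * of_int q2) ^ j) \<in> \<int>"
    by (simp_all only: Ainvpow_mult_vec_nth[OF q])
  from Ints_div_power_3q[OF this(1) \<open>k < j\<close> q(1)] Ints_div_power_3q[OF this(2) \<open>k < j\<close> q(2)]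
  have "(Ainvpow q1 q2 k *v \<xi>) $ 1 \<in> \<int>" "(Ainvpow q1 q2 k *v \<xi>) $ 2 \<in> \<int>"
    by (simp_all only: Ainvpow_mult_vec_nth[OF q])
  then show ?thesis
    using exhaust_2[of i] by auto
qed

lemma orthogonal_set_Suc: "orthogonal_set (\<nu> (Suc k)) \<Lambda> \<Longrightarrow> orthogonal_set (\<nu> k) \<Lambda>"
  by (simp add: orthogonal_set_iff_fourier fourier_nu_Suc[of k])

lemma orthogonal_set_in_coset:
  assumes "orthogonal_set (\<nu> k) \<Lambda>"
  obtains l0 where "\<And>l i. l \<in> \<Lambda> \<Longrightarrow> (Ainvpow q1 q2 k *v (l - l0)) $ i \<in> \<int>"
proof (cases "\<Lambda> = {}")
  case False
  then obtain l0 where "l0 \<in> \<Lambda>"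
    by blast
  have "(Ainvpow q1 q2 k *v (l - l0)) $ i \<in> \<int>" if "l \<in> \<Lambda>" for l i
  proof (cases "l = l0")
    case False
    then have "fourier (\<nu> k) (l - l0) = 0"
      using assms that \<open>l0 \<in> \<Lambda>\<close> by (simp add: orthogonal_set_iff_fourier)
    then show ?thesis
      by (rule fourier_nu_eq_0_imp_Ints)
  qed simp
  then show thesis
    using that by blast
qed blast

lemma orthogonal_set_extends:
  assumes orth: "orthogonal_set (\<nu> (Suc k)) \<Lambda>"
  obtains z where "z \<notin> \<Lambda>" "orthogonal_set (\<nu> k) (insert z \<Lambda>)"
proof -
  let ?B = "Ainvpow q1 q2 (Suc k)"
  obtain l0 where coset: "\<And>l i. l \<in> \<Lambda> \<Longrightarrow> (?B *v (l - l0)) $ i \<in> \<int>"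
    using orthogonal_set_in_coset[OF orth] by blast
  \<comment> \<open>w = A^(k+1) (1/3, 2/3)\<close>
  define w :: "real^2" where
    "w = (\<chi> i. if i = 1 then (3 * of_int q1) ^ Suc k / 3 else 2 * (3 * of_int q2) ^ Suc k / 3)"
  define z where "z = l0 + w"
  have w: "(?B *v w) $ 1 = 1 / 3" "(?B *v w) $ 2 = 2 / 3"
    using q1 q2 by (simp_all add: Ainvpow_mult_vec_nth w_def)
  have mask_0: "digit_mask (?B *v (z - l)) = 0" if "l \<in> \<Lambda>" for l
  proof -
    have "z - l = w - (l - l0)"
      by (simp add: z_def)
    then have "?B *v (z - l) = ?B *v w - ?B *v (l - l0)"
      by (simp only: matrix_vector_mult_diff_distrib)
    then have "(?B *v (z - l)) $ 1 - 1 / 3 = - (?B *v (l - l0)) $ 1"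
        "(?B *v (z - l)) $ 2 - 2 / 3 = - (?B *v (l - l0)) $ 2"
      by (simp_all add: w)
    then show ?thesis
      using coset[OF that] by (intro digit_mask_eq_0_if) (simp_all add: Ints_minus)
  qed
  have "z \<notin> \<Lambda>"
  proof
    assume "z \<in> \<Lambda>"
    \<comment> \<open>then the mask would vanish at A^-(k+1) (z - z) = 0\<close>
    from mask_0[OF this] show False
      by (simp add: digit_mask_def)
  qed
  moreover have "fourier (\<nu> k) (z - l) = 0" "fourier (\<nu> k) (l - z) = 0" if "l \<in> \<Lambda>" for l
    using fourier_nu_Suc[of k "z - l"] fourier_uminus[of "\<nu> k" "z - l"] mask_0[OF that]
    by simp_all
  ultimately have "orthogonal_set (\<nu> k) (insert z \<Lambda>)"
    using orthogonal_set_Suc[OF orth] by (auto simp: orthogonal_set_iff_fourier)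
  with \<open>z \<notin> \<Lambda>\<close> show thesis
    by (rule that)
qed

end

theorem lemma2p7:
  fixes q1 q2 :: int and \<nu> :: "nat \<Rightarrow> (real^2) measure"
    and n :: nat and \<Lambda> :: "(real^2) set"
  assumes "1 \<le> q1" and "q1 \<le> q2"
    and "\<And>k. prob_space (\<nu> k)"
    and "\<And>k. sets (\<nu> k) = sets borel"
    and "\<And>k. weak_conv_seq (\<lambda>m. measure_pmf (fin_conv q1 q2 k m)) (\<nu> k)"
    and "n \<ge> 1"
    and "orthogonal_set (\<nu> n) \<Lambda>"
  shows "orthogonal_set (\<nu> (n - 1)) \<Lambda> \<and> \<not> maximal_orthogonal_set (\<nu> (n - 1)) \<Lambda>"
proof -
  interpret tail_convolutions q1 q2 \<nu>
  proof (rule tail_convolutions.intro)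
    show "1 \<le> q2"
      using assms(1,2) by linarith
  qed (fact assms)+
  obtain k where n: "n = Suc k"
    using \<open>n \<ge> 1\<close> by (cases n) auto
  have orth: "orthogonal_set (\<nu> (Suc k)) \<Lambda>"
    using assms(7) unfolding n .
  obtain z where "z \<notin> \<Lambda>" "orthogonal_set (\<nu> k) (insert z \<Lambda>)"
    using orthogonal_set_extends[OF orth] .
  then have "\<not> maximal_orthogonal_set (\<nu> k) \<Lambda>"
    unfolding maximal_orthogonal_set_def by blast
  then show ?thesis
    using orthogonal_set_Suc[OF orth] by (simp add: n)
qed

end
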